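(* Let $X$ be a countably based topological space. Then $\mathbf{K}(\mathbf{A}(X))$ with the upper Vietoris topology is homeomorphic to $\mathbf{O}(\mathbf{O}(X))$ with the Scott topology, via the map $\phi\colon\mathbf{K}(\mathbf{A}(X))\to\mathbf{O}(\mathbf{O}(X))$ and its inverse $\psi\colon\mathbf{O}(\mathbf{O}(X))\to\mathbf{K}(\mathbf{A}(X))$. Moreover, the Scott topology on $\mathbf{O}(\mathbf{O}(X))$ has a subbasis given by the sets $$\boxtimes U=\{\mathcal{H}\in\mathbf{O}(\mathbf{O}(X))\mid U\in\mathcal{H}\}$$ for open $U\subseteq X$.
   Context: For a topological space $Y$: $\mathbf{A}(Y)$ is the set of all closed subsets of $Y$ with the lower Vietoris topology, generated by the sets $\Diamond U=\{A\in\mathbf{A}(Y)\mid A\cap U\neq\emptyset\}$ for $U\subseteq Y$ open. $\mathbf{K}(Y)$ is the set of all compact saturated subsets of $Y$ with the upper Vietoris topology, generated by the sets $\Box U=\{K\in\mathbf{K}(Y)\mid K\subseteq U\}$ for $U\subseteq Y$ open. (Compact: every open cover has a finite subcover. Saturated: equal to the intersection of all its open neighborhoods.) $\mathbf{O}(Y)$ is the lattice of open subsets of $Y$ ordered by inclusion and equipped with the Scott topology; so $\mathbf{O}(\mathbf{O}(X))$ is the lattice of Scott-open subsets of $\mathbf{O}(X)$, again with its Scott topology. The maps (which are well-defined for every topological space $X$) are $$\phi(\mathcal{K})=\{U\in\mathbf{O}(X)\mid\mathcal{K}\in\Box\Diamond U\},\qquad\psi(\mathcal{H})=\bigcap_{U\in\mathcal{H}}\Diamond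 U,$$ where $\Box\Diamond U=\{\mathcal{K}\in\mathbf{K}(\mathbf{A}(X))\mid(\forall A\in\mathcal{K})\,A\cap U\neq\emptyset\}$ and the empty intersection is $\mathbf{A}(X)$. *)

theory Defs
  imports "HOL-Analysis.Analysis" "HOL-Library.Lub_Glb"
begin

text \<open>The topology on \<open>S\<close> with subbasis \<open>\<B>\<close>. The whole space \<open>S\<close> counts as the empty
  intersection, so \<open>\<B>\<close> need not cover \<open>S\<close> (unlike for \<^const>\<open>topology_generated_by\<close>); this
  matters below, since the empty closed set meets no open set.\<close>

definition topology_from_subbasis :: "'a set \<Rightarrow> 'a set set \<Rightarrow> 'a topology" where
  "topology_from_subbasis S \<B> =
     topology (arbitrary union_of (finite intersection_of (\<lambda>B. B \<in> \<B>) relative_to S))"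

lemma openin_topology_from_subbasis:
  "openin (topology_from_subbasis S \<B>) =
     arbitrary union_of (finite intersection_of (\<lambda>B. B \<in> \<B>) relative_to S)"
  unfolding topology_from_subbasis_def by (simp add: istopology_subbase)

lemma topspace_topology_from_subbasis [simp]: "topspace (topology_from_subbasis S \<B>) = S"
  unfolding topology_from_subbasis_def by (simp add: topspace_subbase)


definition directed_subset :: "'a::order set \<Rightarrow> bool" where
  "directed_subset D \<longleftrightarrow> D \<noteq> {} \<and> (\<forall>x\<in>D. \<forall>y\<in>D. \<exists>z\<in>D. x \<le> z \<and> y \<le> z)"

definition scott_open :: "'a::order set \<Rightarrow> 'a set \<Rightarrow> bool" where
  "scott_open P W \<longleftrightarrow>
     W \<subseteq> P \<and>
     (\<forall>x\<in>W. \<forall>y\<in>P. x \<le> y \<longrightarrow> y \<in> W) \<and>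
     (\<forall>D s. D \<subseteq> P \<longrightarrow> directed_subset D \<longrightarrow> isLub P D s \<longrightarrow> s \<in> W \<longrightarrow> D \<inter> W \<noteq> {})"

definition scott_topology :: "'a::order set \<Rightarrow> 'a topology" where
  "scott_topology P = topology (scott_open P)"

lemma scott_openI:
  assumes "W \<subseteq> P"
    and "\<And>x y. x \<in> W \<Longrightarrow> y \<in> P \<Longrightarrow> x \<le> y \<Longrightarrow> y \<in> W"
    and "\<And>D s. D \<subseteq> P \<Longrightarrow> directed_subset D \<Longrightarrow> isLub P D s \<Longrightarrow> s \<in> W \<Longrightarrow> \<exists>d\<in>D. d \<in> W"
  shows "scott_open P W"
  unfolding scott_open_def
proof (intro conjI allI impI ballI)
  show "W \<subseteq> P" by (fact assms(1))
  show "y \<in> W" if "x \<in> W" "y \<in> P" "x \<le> y" for x y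
    using that by (rule assms(2))
  show "D \<inter> W \<noteq> {}" if "D \<subseteq> P" "directed_subset D" "isLub P D s" "s \<in> W" for D s
    using assms(3)[OF that] by auto
qed

lemma scott_open_subset: "scott_open P W \<Longrightarrow> W \<subseteq> P"
  unfolding scott_open_def by (elim conjE)

lemma scott_open_up: "scott_open P W \<Longrightarrow> x \<in> W \<Longrightarrow> x \<le> y \<Longrightarrow> y \<in> P \<Longrightarrow> y \<in> W"
  unfolding scott_open_def by (elim conjE) simp

lemma scott_open_directed:
  assumes "scott_open P W" "D \<subseteq> P" "directed_subset D" "isLub P D s" "s \<in> W"
  shows "\<exists>d\<in>D. d \<in> W"
proof -
  have "D \<inter> W \<noteq> {}"
    using assms(1) unfolding scott_open_def
    by (elim conjE allE[of _ D] allE[of _ s]) (simp add: assms)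
  then show ?thesis by auto
qed

lemma istopology_scott_open: "istopology (scott_open P)"
  unfolding istopology_def
proof (intro conjI allI impI)
  fix V W assume V: "scott_open P V" and W: "scott_open P W"
  show "scott_open P (V \<inter> W)"
  proof (rule scott_openI)
    show "V \<inter> W \<subseteq> P"
      using scott_open_subset[OF V] by blast
    show "y \<in> V \<inter> W" if "x \<in> V \<inter> W" "y \<in> P" "x \<le> y" for x y
      using that scott_open_up[OF V] scott_open_up[OF W] by auto
    show "\<exists>d\<in>D. d \<in> V \<inter> W"
      if D: "D \<subseteq> P" "directed_subset D" "isLub P D s" "s \<in> V \<inter> W" for D s
    proof -
      obtain x where x: "x \<in> D" "x \<in> V"
        using scott_open_directed[OF V D(1-3)] D(4) by auto
      obtain y where y: "y \<in> D" "y \<in> W"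
        using scott_open_directed[OF W D(1-3)] D(4) by auto
      obtain z where z: "z \<in> D" "x \<le> z" "y \<le> z"
        using D(2) x(1) y(1) unfolding directed_subset_def by metis
      have "z \<in> P" using z(1) D(1) by auto
      then have "z \<in> V" "z \<in> W"
        using scott_open_up[OF V x(2)] scott_open_up[OF W y(2)] z by auto
      then show ?thesis using z(1) by auto
    qed
  qed
next
  fix \<W> assume \<W>: "\<forall>W\<in>\<W>. scott_open P W"
  show "scott_open P (\<Union>\<W>)"
  proof (rule scott_openI)
    show "\<Union>\<W> \<subseteq> P"
      using \<W> scott_open_subset by (metis Sup_least)
    show "y \<in> \<Union>\<W>" if "x \<in> \<Union>\<W>" "y \<in> P" "x \<le> y" for x y
      using that \<W> scott_open_up by (metis UnionE UnionI)
    show "\<exists>d\<in>D. d \<in> \<Union>\<W>"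
      if D: "D \<subseteq> P" "directed_subset D" "isLub P D s" "s \<in> \<Union>\<W>" for D s
    proof -
      obtain W where W: "W \<in> \<W>" "s \<in> W" using D(4) by auto
      then have "scott_open P W" using \<W> by auto
      from scott_open_directed[OF this D(1-3) W(2)] W(1) show ?thesis by auto
    qed
  qed
qed

lemma openin_scott_topology [simp]: "openin (scott_topology P) = scott_open P"
  unfolding scott_topology_def by (simp add: istopology_scott_open)

lemma topspace_scott_topology [simp]: "topspace (scott_topology P) = P"
proof -
  have "scott_open P P"
    by (rule scott_openI) (auto simp: directed_subset_def)
  then show ?thesis
    unfolding topspace_def by (auto dest: scott_open_subset)
qed

definition opens_space :: "'a topology \<Rightarrow> 'a set topology"  (\<open>\<^bold>O\<close>) where
  "\<^bold>O Y = scott_topology {U. openin Y U}"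

lemma topspace_opens_space [simp]: "topspace (\<^bold>O Y) = {U. openin Y U}"
  unfolding opens_space_def by simp

lemma isLub_open_sets:
  assumes "D \<subseteq> {U. openin Y U}"
  shows "isLub {U. openin Y U} D s \<longleftrightarrow> s = \<Union>D"
proof -
  have "openin Y (\<Union>D)"
    using assms by (auto intro: openin_Union)
  then have lub: "isLub {U. openin Y U} D (\<Union>D)"
    by (auto simp: isLub_def leastP_def isUb_def setle_def setge_def)
  show ?thesis
  proof
    assume s: "isLub {U. openin Y U} D s"
    show "s = \<Union>D"
    proof (rule order_antisym)
      show "s \<subseteq> \<Union>D"
        using s lub by (simp add: isLub_def leastP_def setge_def)
      show "\<Union>D \<subseteq> s"
        using s lub by (simp add: isLub_def leastP_def setge_def)
    qed
  qed (simp add: lub)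
qed


definition closed_sets :: "'a topology \<Rightarrow> 'a set set" where
  "closed_sets Y = {A. closedin Y A}"

definition vietoris_diamond :: "'a topology \<Rightarrow> 'a set \<Rightarrow> 'a set set" where
  "vietoris_diamond Y U = {A \<in> closed_sets Y. A \<inter> U \<noteq> {}}"

definition lower_space :: "'a topology \<Rightarrow> 'a set topology"  (\<open>\<^bold>A\<close>) where
  "\<^bold>A Y = topology_from_subbasis (closed_sets Y) {vietoris_diamond Y U |U. openin Y U}"

lemma topspace_lower_space [simp]: "topspace (\<^bold>A Y) = closed_sets Y"
  unfolding lower_space_def by simp


definition saturatedin :: "'a topology \<Rightarrow> 'a set \<Rightarrow> bool" where
  "saturatedin Y K \<longleftrightarrow> K = \<Inter>{U. openin Y U \<and> K \<subseteq> U}"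

definition compact_saturated_sets :: "'a topology \<Rightarrow> 'a set set" where
  "compact_saturated_sets Y = {K. compactin Y K \<and> saturatedin Y K}"

definition vietoris_box :: "'a topology \<Rightarrow> 'a set \<Rightarrow> 'a set set" where
  "vietoris_box Y U = {K \<in> compact_saturated_sets Y. K \<subseteq> U}"

definition upper_space :: "'a topology \<Rightarrow> 'a set topology"  (\<open>\<^bold>K\<close>) where
  "\<^bold>K Y = topology_from_subbasis (compact_saturated_sets Y) {vietoris_box Y U |U. openin Y U}"

lemma topspace_upper_space [simp]: "topspace (\<^bold>K Y) = compact_saturated_sets Y"
  unfolding upper_space_def by simp


definition phi :: "'a topology \<Rightarrow> 'a set set \<Rightarrow> 'a set set"  (\<open>\<phi>\<close>) where
  "\<phi> X \<K> = {U. openin X U \<and> \<K> \<in> vietoris_box (\<^bold>A X) (vietoris_diamond X U)}"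

definition psi :: "'a topology \<Rightarrow> 'a set set \<Rightarrow> 'a set set"  (\<open>\<psi>\<close>) where
  "\<psi> X \<H> = closed_sets X \<inter> (\<Inter>U\<in>\<H>. vietoris_diamond X U)"

definition boxtimes :: "'a topology \<Rightarrow> 'a set \<Rightarrow> 'a set set set"  (\<open>\<boxtimes>\<close>) where
  "\<boxtimes> X U = {\<H>. openin (\<^bold>O X) \<H> \<and> U \<in> \<H>}"

end

theory Submission
  imports Defs
begin

text \<open>Complementation identifies closed sets with open sets, and turns \<open>\<psi> X \<H>\<close> into the complement
  of \<open>\<H>\<close>; Scott openness of \<open>\<H>\<close> is then precisely compactness of \<open>\<psi> X \<H>\<close> by Alexander's subbase
  lemma, and \<open>\<psi>\<close> inverts \<open>\<phi>\<close> because saturated sets of closed sets are upward closed. This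
  matches the topology generated by the sets \<open>\<boxtimes> X U\<close> with the upper Vietoris topology.
  Countability enters only to show that the former is the Scott topology: a Scott open \<open>\<H>\<close> is the
  upward closure of a countable set, so if no finite part of that set forces membership in a Scott
  open \<open>\<W>\<close> around \<open>\<H>\<close>, there are witnesses \<open>N n \<notin> \<W>\<close> containing larger and larger finite parts,
  and the sets \<open>\<H> \<inter> (\<Inter>m\<ge>n. N m)\<close> are Scott open with directed union \<open>\<H>\<close>, a contradiction.\<close>

section \<open>Topologies given by a subbasis\<close>

text \<open>\<open>\<F>\<close> may be empty, and then \<open>S \<inter> \<Inter>\<F>\<close> is
  \<open>S\<close>; this builds in the convention that the whole space is an empty
  intersection.\<close>

lemma openin_topology_from_subbasis_iff:
  "openin (topology_from_subbasis S \<B>) W \<longleftrightarrow>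
     W \<subseteq> S \<and> (\<forall>x\<in>W. \<exists>\<F>. finite \<F> \<and> \<F> \<subseteq> \<B> \<and> x \<in> \<Inter>\<F> \<and> S \<inter> \<Inter>\<F> \<subseteq> W)"
    (is "?L \<longleftrightarrow> ?R")
proof
  assume L: ?L
  have "W \<subseteq> S"
    using openin_subset[OF L] by simp
  moreover have "\<exists>\<F>. finite \<F> \<and> \<F> \<subseteq> \<B> \<and> x \<in> \<Inter>\<F> \<and> S \<inter> \<Inter>\<F> \<subseteq> W" if "x \<in> W" for x
  proof -
    obtain V where V: "(finite intersection_of (\<lambda>B. B \<in> \<B>) relative_to S) V" "x \<in> V" "V \<subseteq> W"
      using L \<open>x \<in> W\<close> unfolding openin_topology_from_subbasis arbitrary_union_of_alt by blast
    then obtain \<F> where "finite \<F>" "\<F> \<subseteq> \<B>" "V = S \<inter> \<Inter>\<F>"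
      unfolding relative_to_def intersection_of_def by auto
    with V show ?thesis by blast
  qed
  ultimately show ?R by blast
next
  assume R: ?R
  show ?L
    unfolding openin_topology_from_subbasis arbitrary_union_of_alt
  proof
    fix x assume "x \<in> W"
    with R obtain \<F> where \<F>: "finite \<F>" "\<F> \<subseteq> \<B>" "x \<in> \<Inter>\<F>" "S \<inter> \<Inter>\<F> \<subseteq> W" by meson
    have "(finite intersection_of (\<lambda>B. B \<in> \<B>) relative_to S) (S \<inter> \<Inter>\<F>)"
      unfolding relative_to_def intersection_of_def using \<F>(1,2) by auto
    then show "\<exists>V. (finite intersection_of (\<lambda>B. B \<in> \<B>) relative_to S) V \<and> x \<in> V \<and> V \<subseteq> W"
      using \<F> R \<open>x \<in> W\<close> by blast
  qed
qed

lemma openin_subbasis_member: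
  assumes "B \<in> \<B>" "B \<subseteq> S"
  shows "openin (topology_from_subbasis S \<B>) B"
  unfolding openin_topology_from_subbasis_iff
  using assms by (intro conjI ballI exI[of _ "{B}"]) auto

lemma topology_from_subbasis_le:
  assumes "topspace T = S" "\<And>B. B \<in> \<B> \<Longrightarrow> openin T B"
    and "openin (topology_from_subbasis S \<B>) W"
  shows "openin T W"
proof (subst openin_subopen, intro ballI)
  fix x assume x: "x \<in> W"
  then obtain \<F> where \<F>: "finite \<F>" "\<F> \<subseteq> \<B>" "x \<in> \<Inter>\<F>" "S \<inter> \<Inter>\<F> \<subseteq> W" and "W \<subseteq> S"
    using assms(3) unfolding openin_topology_from_subbasis_iff by meson
  have "openin T ((\<Inter>B\<in>\<F>. B) \<inter> topspace T)"
    using \<F> assms(2) by (intro openin_INT) auto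
  then show "\<exists>V. openin T V \<and> x \<in> V \<and> V \<subseteq> W"
    using \<F> x \<open>W \<subseteq> S\<close> assms(1) by (intro exI[of _ "(\<Inter>B\<in>\<F>. B) \<inter> topspace T"]) auto
qed

lemma continuous_map_into_subbasis:
  assumes "\<And>x. x \<in> topspace T \<Longrightarrow> f x \<in> S"
    and "\<And>B. B \<in> \<B> \<Longrightarrow> openin T {x \<in> topspace T. f x \<in> B}"
  shows "continuous_map T (topology_from_subbasis S \<B>) f"
  unfolding continuous_map_def
proof (intro conjI allI impI)
  show "f \<in> topspace T \<rightarrow> topspace (topology_from_subbasis S \<B>)"
    using assms(1) by simp
  fix W assume W: "openin (topology_from_subbasis S \<B>) W"
  show "openin T {x \<in> topspace T. f x \<in> W}"
  proof (subst openin_subopen, intro ballI)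
    fix x assume x: "x \<in> {x \<in> topspace T. f x \<in> W}"
    then obtain \<F> where \<F>: "finite \<F>" "\<F> \<subseteq> \<B>" "f x \<in> \<Inter>\<F>" "S \<inter> \<Inter>\<F> \<subseteq> W"
      using W unfolding openin_topology_from_subbasis_iff by blast
    define V where "V = (\<Inter>B\<in>\<F>. {x \<in> topspace T. f x \<in> B}) \<inter> topspace T"
    have "openin T V"
      unfolding V_def using \<F> assms(2) by (intro openin_INT) auto
    moreover have "x \<in> V" "V \<subseteq> {x \<in> topspace T. f x \<in> W}"
      using x \<F> assms(1) unfolding V_def by auto
    ultimately show "\<exists>V. openin T V \<and> x \<in> V \<and> V \<subseteq> {x \<in> topspace T. f x \<in> W}"
      by blast
  qed
qed

text \<open>Adjoining \<open>K\<close> adds no open sets to the subspace, but it makes the subbasis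
  cover \<open>K\<close>, as Alexander's lemma requires.\<close>

lemma subtopology_topology_from_subbasis:
  assumes "K \<subseteq> S"
  shows "subtopology (topology_from_subbasis S \<B>) K = topology_from_subbasis K (insert K \<B>)"
proof (rule topology_eq[THEN iffD2], intro allI iffI)
  fix W assume "openin (subtopology (topology_from_subbasis S \<B>) K) W"
  then obtain V where V: "openin (topology_from_subbasis S \<B>) V" "W = V \<inter> K"
    unfolding openin_subtopology by blast
  show "openin (topology_from_subbasis K (insert K \<B>)) W"
    unfolding openin_topology_from_subbasis_iff
  proof (intro conjI ballI)
    fix x assume "x \<in> W"
    then obtain \<F> where "finite \<F>" "\<F> \<subseteq> \<B>" "x \<in> \<Inter>\<F>" "S \<inter> \<Inter>\<F> \<subseteq> V"
      using V unfolding openin_topology_from_subbasis_iff by blast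
    then show "\<exists>\<F>. finite \<F> \<and> \<F> \<subseteq> insert K \<B> \<and> x \<in> \<Inter>\<F> \<and> K \<inter> \<Inter>\<F> \<subseteq> W"
      using V assms by (intro exI[of _ \<F>]) auto
  qed (use V in auto)
next
  fix W assume W: "openin (topology_from_subbasis K (insert K \<B>)) W"
  show "openin (subtopology (topology_from_subbasis S \<B>) K) W"
  proof (subst openin_subopen, intro ballI)
    fix x assume x: "x \<in> W"
    then obtain \<F> where \<F>: "finite \<F>" "\<F> \<subseteq> insert K \<B>" "x \<in> \<Inter>\<F>" "K \<inter> \<Inter>\<F> \<subseteq> W" "x \<in> K"
      using W unfolding openin_topology_from_subbasis_iff by blast
    \<comment> \<open>\<open>K\<close> need not be open in the larger space, so it is dropped from
      \<open>\<F>\<close> here and restored by intersecting with \<open>K\<close>.\<close>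
    define V where "V = S \<inter> \<Inter>(\<F> - {K})"
    have "openin (topology_from_subbasis S \<B>) V"
      unfolding openin_topology_from_subbasis_iff V_def
      using \<F> by (intro conjI ballI exI[of _ "\<F> - {K}"]) auto
    then have "openin (subtopology (topology_from_subbasis S \<B>) K) (V \<inter> K)"
      unfolding openin_subtopology by blast
    moreover have "x \<in> V \<inter> K" "V \<inter> K \<subseteq> W"
      using \<F> assms unfolding V_def by auto
    ultimately show
      "\<exists>V. openin (subtopology (topology_from_subbasis S \<B>) K) V \<and> x \<in> V \<and> V \<subseteq> W"
      by blast
  qed
qed

text \<open>Alexander's subbase lemma for the subspace \<open>K\<close>. A cover using the adjoined
  member \<open>K\<close> has a one-element subcover, so only covers from \<open>\<B>\<close> have
  to be checked.\<close>

lemma compactin_topology_from_subbasis: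
  assumes "K \<subseteq> S"
    and "\<And>\<C>. \<C> \<subseteq> \<B> \<Longrightarrow> K \<subseteq> \<Union>\<C> \<Longrightarrow> \<exists>\<C>'. finite \<C>' \<and> \<C>' \<subseteq> \<C> \<and> K \<subseteq> \<Union>\<C>'"
  shows "compactin (topology_from_subbasis S \<B>) K"
proof -
  have "compact_space (topology_from_subbasis K (insert K \<B>))"
  proof (rule Alexander_subbase_alt)
    show "K \<subseteq> \<Union>(insert K \<B>)" by blast
    show "\<exists>\<C>'. finite \<C>' \<and> \<C>' \<subseteq> \<C> \<and> K \<subseteq> \<Union>\<C>'" if "\<C> \<subseteq> insert K \<B>" "K \<subseteq> \<Union>\<C>" for \<C>
    proof (cases "K \<in> \<C>")
      case True
      then show ?thesis by (intro exI[of _ "{K}"]) auto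
    next
      case False
      with that(1) have "\<C> \<subseteq> \<B>" by blast
      then show ?thesis using that(2) by (rule assms(2))
    qed
  qed (simp add: topology_from_subbasis_def)
  then show ?thesis
    using assms(1) by (simp add: compactin_subspace subtopology_topology_from_subbasis)
qed

section \<open>The powerspaces and the maps between them\<close>

lemma scott_open_opensI:
  assumes "\<And>U. U \<in> \<W> \<Longrightarrow> openin Y U"
    and "\<And>U V. U \<in> \<W> \<Longrightarrow> openin Y V \<Longrightarrow> U \<subseteq> V \<Longrightarrow> V \<in> \<W>"
    and "\<And>D. (\<And>U. U \<in> D \<Longrightarrow> openin Y U) \<Longrightarrow> directed_subset D \<Longrightarrow> \<Union>D \<in> \<W> \<Longrightarrow> \<exists>U\<in>D. U \<in> \<W>"
  shows "openin (\<^bold>O Y) \<W>"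
  unfolding opens_space_def openin_scott_topology
proof (rule scott_openI)
  show "\<W> \<subseteq> {U. openin Y U}" using assms(1) by blast
  show "\<exists>d\<in>D. d \<in> \<W>"
    if "D \<subseteq> {U. openin Y U}" "directed_subset D" "isLub {U. openin Y U} D s" "s \<in> \<W>" for D s
  proof (rule assms(3))
    show "openin Y U" if "U \<in> D" for U using that \<open>D \<subseteq> {U. openin Y U}\<close> by blast
    show "\<Union>D \<in> \<W>" using that(3,4) isLub_open_sets[OF that(1)] by simp
  qed (rule that(2))
qed (use assms(2) in auto)

lemma openin_opens_space_open: "openin (\<^bold>O Y) \<W> \<Longrightarrow> U \<in> \<W> \<Longrightarrow> openin Y U"
  by (drule openin_subset) auto

lemma openin_opens_space_up:
  "openin (\<^bold>O Y) \<W> \<Longrightarrow> U \<in> \<W> \<Longrightarrow> U \<subseteq> V \<Longrightarrow> openin Y V \<Longrightarrow> V \<in> \<W>"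
  unfolding opens_space_def by (auto dest: scott_open_up)

lemma openin_opens_space_directed:
  assumes "openin (\<^bold>O Y) \<W>" "\<And>U. U \<in> D \<Longrightarrow> openin Y U" "directed_subset D" "\<Union>D \<in> \<W>"
  shows "\<exists>U\<in>D. U \<in> \<W>"
proof -
  have D: "D \<subseteq> {U. openin Y U}" using assms(2) by blast
  show ?thesis
    using assms scott_open_directed[OF _ D assms(3) isLub_open_sets[OF D, THEN iffD2, OF refl]]
    unfolding opens_space_def by simp
qed

lemma directed_subset_finite_Unions:
  fixes \<C> :: "'a set set"
  shows "directed_subset {\<Union>\<F> |\<F>. finite \<F> \<and> \<F> \<subseteq> \<C>}"
  unfolding directed_subset_def
proof (intro conjI ballI)
  show "{\<Union>\<F> |\<F>. finite \<F> \<and> \<F> \<subseteq> \<C>} \<noteq> {}" by blast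
  fix x y assume "x \<in> {\<Union>\<F> |\<F>. finite \<F> \<and> \<F> \<subseteq> \<C>}" "y \<in> {\<Union>\<F> |\<F>. finite \<F> \<and> \<F> \<subseteq> \<C>}"
  then obtain \<F> \<G> where "finite \<F>" "\<F> \<subseteq> \<C>" "x = \<Union>\<F>" "finite \<G>" "\<G> \<subseteq> \<C>" "y = \<Union>\<G>" by blast
  then show "\<exists>z\<in>{\<Union>\<F> |\<F>. finite \<F> \<and> \<F> \<subseteq> \<C>}. x \<le> z \<and> y \<le> z"
    by (intro bexI[of _ "\<Union>(\<F> \<union> \<G>)"]) (blast intro: finite_UnI)+
qed

text \<open>A union is the directed union of its finite subunions, so Scott openness extracts a
  finite subfamily. This later supplies the finite subcovers of
  \<open>\<psi> X \<H>\<close>.\<close>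

lemma openin_opens_space_Union:
  assumes "openin (\<^bold>O Y) \<W>" "\<And>U. U \<in> \<C> \<Longrightarrow> openin Y U" "\<Union>\<C> \<in> \<W>"
  shows "\<exists>\<F>. finite \<F> \<and> \<F> \<subseteq> \<C> \<and> \<Union>\<F> \<in> \<W>"
proof -
  have "\<Union>{\<Union>\<F> |\<F>. finite \<F> \<and> \<F> \<subseteq> \<C>} = \<Union>\<C>"
  proof
    show "\<Union>\<C> \<subseteq> \<Union>{\<Union>\<F> |\<F>. finite \<F> \<and> \<F> \<subseteq> \<C>}"
    proof
      fix x assume "x \<in> \<Union>\<C>"
      then obtain U where "U \<in> \<C>" "x \<in> U" by blast
      then have "\<Union>{U} \<in> {\<Union>\<F> |\<F>. finite \<F> \<and> \<F> \<subseteq> \<C>}" by blast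
      with \<open>x \<in> U\<close> show "x \<in> \<Union>{\<Union>\<F> |\<F>. finite \<F> \<and> \<F> \<subseteq> \<C>}" by auto
    qed
  qed blast
  moreover have "openin Y U" if "U \<in> {\<Union>\<F> |\<F>. finite \<F> \<and> \<F> \<subseteq> \<C>}" for U
    using that assms(2) by (auto intro!: openin_Union)
  ultimately have "\<exists>U\<in>{\<Union>\<F> |\<F>. finite \<F> \<and> \<F> \<subseteq> \<C>}. U \<in> \<W>"
    using assms(1,3)
    by (intro openin_opens_space_directed[OF _ _ directed_subset_finite_Unions]) simp_all
  then show ?thesis by blast
qed

section \<open>The lower Vietoris topology\<close>

lemma openin_vietoris_diamond: "openin X U \<Longrightarrow> openin (\<^bold>A X) (vietoris_diamond X U)"
  unfolding lower_space_def
  by (intro openin_subbasis_member) (auto simp: vietoris_diamond_def)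

lemma vietoris_diamond_Union: "vietoris_diamond X (\<Union>\<C>) = (\<Union>U\<in>\<C>. vietoris_diamond X U)"
  unfolding vietoris_diamond_def by blast

lemma vietoris_diamond_mono: "U \<subseteq> V \<Longrightarrow> vietoris_diamond X U \<subseteq> vietoris_diamond X V"
  unfolding vietoris_diamond_def by blast

lemma openin_lower_space_basic:
  assumes "openin (\<^bold>A X) W" "A \<in> W"
  obtains F where "finite F" "\<And>U. U \<in> F \<Longrightarrow> openin X U" "A \<in> closed_sets X"
    "A \<in> (\<Inter>U\<in>F. vietoris_diamond X U)"
    "closed_sets X \<inter> (\<Inter>U\<in>F. vietoris_diamond X U) \<subseteq> W"
proof -
  obtain \<F> where \<F>: "finite \<F>" "\<F> \<subseteq> vietoris_diamond X ` {U. openin X U}" "A \<in> \<Inter>\<F>"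
    "closed_sets X \<inter> \<Inter>\<F> \<subseteq> W" and "A \<in> closed_sets X"
    using assms unfolding lower_space_def openin_topology_from_subbasis_iff image_Collect by blast
  moreover obtain F where "F \<subseteq> {U. openin X U}" "finite F" "\<F> = vietoris_diamond X ` F"
    using finite_subset_image[OF \<F>(1,2)] by blast
  ultimately show ?thesis using that[of F] by blast
qed

text \<open>Diamonds are stable under enlarging the closed set, hence so are their finite
  intersections and all open sets. This makes saturated families upward closed.\<close>

lemma openin_lower_space_up:
  assumes "openin (\<^bold>A X) W" "A \<in> W" "A \<subseteq> B" "closedin X B"
  shows "B \<in> W"
proof -
  obtain F where F: "A \<in> (\<Inter>U\<in>F. vietoris_diamond X U)"
    "closed_sets X \<inter> (\<Inter>U\<in>F. vietoris_diamond X U) \<subseteq> W"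
    using openin_lower_space_basic[OF assms(1,2)] by metis
  then have "B \<in> closed_sets X \<inter> (\<Inter>U\<in>F. vietoris_diamond X U)"
    using assms(3,4) unfolding vietoris_diamond_def closed_sets_def by blast
  with F show ?thesis by blast
qed

section \<open>The maps \<open>\<phi>\<close> and \<open>\<psi>\<close> as mutually inverse
  bijections\<close>

lemma phi_iff:
  assumes "\<K> \<in> compact_saturated_sets (\<^bold>A X)"
  shows "U \<in> \<phi> X \<K> \<longleftrightarrow> openin X U \<and> \<K> \<subseteq> vietoris_diamond X U"
  using assms unfolding phi_def vietoris_box_def by blast

text \<open>If the union of a directed \<open>D\<close> belongs to \<open>\<phi> X \<K>\<close>, the
  diamonds of the members of \<open>D\<close> cover \<open>\<K>\<close>. Compactness leaves finitely
  many of them, and directedness then leaves a single one.\<close>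

lemma openin_phi:
  assumes \<K>: "\<K> \<in> compact_saturated_sets (\<^bold>A X)"
  shows "openin (\<^bold>O X) (\<phi> X \<K>)"
proof (rule scott_open_opensI)
  show "openin X U" if "U \<in> \<phi> X \<K>" for U
    using that phi_iff[OF \<K>] by blast
  show "V \<in> \<phi> X \<K>" if "U \<in> \<phi> X \<K>" "openin X V" "U \<subseteq> V" for U V
    using that phi_iff[OF \<K>] vietoris_diamond_mono[OF \<open>U \<subseteq> V\<close>] by blast
  fix D :: "'a set set"
  assume D: "\<And>U. U \<in> D \<Longrightarrow> openin X U" "directed_subset D" "\<Union>D \<in> \<phi> X \<K>"
  have "compactin (\<^bold>A X) \<K>" using \<K> by (simp add: compact_saturated_sets_def)
  moreover have "\<K> \<subseteq> \<Union>(vietoris_diamond X ` D)"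
    using D(3) phi_iff[OF \<K>] vietoris_diamond_Union by blast
  moreover have "openin (\<^bold>A X) W" if "W \<in> vietoris_diamond X ` D" for W
    using that D(1) openin_vietoris_diamond by blast
  ultimately obtain \<F> where "finite \<F>" "\<F> \<subseteq> vietoris_diamond X ` D" "\<K> \<subseteq> \<Union>\<F>"
    unfolding compactin_def by meson
  then obtain F where F: "F \<subseteq> D" "finite F" "\<K> \<subseteq> \<Union>(vietoris_diamond X ` F)"
    by (metis finite_subset_image)
  \<comment> \<open>A finite subset of a directed set has an upper bound in it; nonemptiness of
    \<open>D\<close> handles the empty subset.\<close>
  have "\<exists>V\<in>D. \<Union>F \<subseteq> V"
    using F(2,1)
  proof (induction F rule: finite_induct)
    case empty
    then show ?case using D(2) by (auto simp: directed_subset_def)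
  next
    case (insert U F)
    then obtain V where V: "V \<in> D" "\<Union>F \<subseteq> V" by auto
    moreover have "U \<in> D" using insert.prems by simp
    ultimately obtain Z where "Z \<in> D" "U \<subseteq> Z" "V \<subseteq> Z"
      using D(2) unfolding directed_subset_def by blast
    with V show ?case by (intro bexI[of _ Z]) auto
  qed
  then obtain V where "V \<in> D" "\<Union>F \<subseteq> V" by (rule bexE)
  moreover have "\<K> \<subseteq> vietoris_diamond X V"
    using F(3) vietoris_diamond_mono[OF \<open>\<Union>F \<subseteq> V\<close>, of X]
    unfolding vietoris_diamond_Union by (rule subset_trans)
  ultimately show "\<exists>U\<in>D. U \<in> \<phi> X \<K>"
    using D(1) phi_iff[OF \<K>, of V] by (intro bexI[of _ V]) auto
qed

text \<open>A closed set misses a member of \<open>\<H>\<close> just when its complement contains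
  that member; the complement is open, so upward closure puts it into \<open>\<H>\<close>.\<close>

lemma psi_eq_complements:
  assumes "openin (\<^bold>O X) \<H>"
  shows "\<psi> X \<H> = {A \<in> closed_sets X. topspace X - A \<notin> \<H>}"
proof (intro equalityI subsetI)
  fix A assume "A \<in> \<psi> X \<H>"
  then show "A \<in> {A \<in> closed_sets X. topspace X - A \<notin> \<H>}"
    unfolding psi_def vietoris_diamond_def by blast
next
  fix A assume A: "A \<in> {A \<in> closed_sets X. topspace X - A \<notin> \<H>}"
  have "A \<inter> U \<noteq> {}" if "U \<in> \<H>" for U
  proof
    assume "A \<inter> U = {}"
    then have "U \<subseteq> topspace X - A"
      using openin_subset[OF openin_opens_space_open[OF assms that]] by blast
    then have "topspace X - A \<in> \<H>"
      using A openin_opens_space_up[OF assms that] by (auto simp: closed_sets_def)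
    with A show False by blast
  qed
  with A show "A \<in> \<psi> X \<H>"
    unfolding psi_def vietoris_diamond_def by blast
qed

text \<open>The dictionary between the two sides: compactness of \<open>\<psi> X \<H>\<close>, the
  identity \<open>phi_psi\<close> and the continuity of \<open>\<psi> X\<close> all rest on
  it.\<close>

lemma psi_subset_diamond_iff:
  assumes "openin (\<^bold>O X) \<H>" "openin X U"
  shows "\<psi> X \<H> \<subseteq> vietoris_diamond X U \<longleftrightarrow> U \<in> \<H>"
proof
  assume L: "\<psi> X \<H> \<subseteq> vietoris_diamond X U"
  \<comment> \<open>The complement of \<open>U\<close> is the closed set to test: it misses
    \<open>U\<close>, so it cannot lie in \<open>\<psi> X \<H>\<close>.\<close>
  have "topspace X - U \<notin> vietoris_diamond X U"
    by (auto simp: vietoris_diamond_def)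
  then have "topspace X - (topspace X - U) \<in> \<H>"
    using L assms by (auto simp: psi_eq_complements closed_sets_def)
  then show "U \<in> \<H>"
    using openin_subset[OF assms(2)] by (simp add: double_diff)
qed (auto simp: psi_def)

text \<open>A cover by diamonds amounts to the single diamond of a union. The dictionary puts that
  union into \<open>\<H>\<close>, and Scott openness keeps finitely many pieces. Saturation holds
  because \<open>\<psi> X \<H>\<close> is an intersection of open sets.\<close>

lemma psi_compact_saturated:
  assumes "openin (\<^bold>O X) \<H>"
  shows "\<psi> X \<H> \<in> compact_saturated_sets (\<^bold>A X)"
  unfolding compact_saturated_sets_def
proof (intro CollectI conjI)
  show "compactin (\<^bold>A X) (\<psi> X \<H>)"
    unfolding lower_space_def
  proof (rule compactin_topology_from_subbasis)
    show "\<psi> X \<H> \<subseteq> closed_sets X" by (auto simp: psi_def)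
    fix \<C> assume "\<C> \<subseteq> {vietoris_diamond X U |U. openin X U}" and cover: "\<psi> X \<H> \<subseteq> \<Union>\<C>"
    then obtain C where C: "C \<subseteq> {U. openin X U}" "\<C> = vietoris_diamond X ` C"
      unfolding image_Collect[symmetric] using subset_imageE by metis
    have "\<Union>C \<in> \<H>"
      using cover C psi_subset_diamond_iff[OF assms, of "\<Union>C"] openin_Union[of C X]
      by (auto simp: vietoris_diamond_Union)
    then obtain F where F: "finite F" "F \<subseteq> C" "\<Union>F \<in> \<H>"
      using openin_opens_space_Union[OF assms, of C] C(1) by blast
    then have "\<psi> X \<H> \<subseteq> \<Union>(vietoris_diamond X ` F)"
      using psi_subset_diamond_iff[OF assms, of "\<Union>F"] openin_opens_space_open[OF assms]
      by (simp add: vietoris_diamond_Union)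
    then show "\<exists>\<C>'. finite \<C>' \<and> \<C>' \<subseteq> \<C> \<and> \<psi> X \<H> \<subseteq> \<Union>\<C>'"
      using F C by (intro exI[of _ "vietoris_diamond X ` F"]) auto
  qed
  show "saturatedin (\<^bold>A X) (\<psi> X \<H>)"
    unfolding saturatedin_def
  proof (intro equalityI subsetI)
    fix A assume A: "A \<in> \<Inter>{W. openin (\<^bold>A X) W \<and> \<psi> X \<H> \<subseteq> W}"
    \<comment> \<open>The whole space counts among the neighbourhoods, which ensures that
      \<open>A\<close> is closed even when \<open>\<H>\<close> is empty.\<close>
    have "openin (\<^bold>A X) (closed_sets X)"
      using openin_topspace[of "\<^bold>A X"] by simp
    then have "A \<in> closed_sets X"
      using A by (auto simp: psi_def)
    moreover have "A \<in> vietoris_diamond X U" if "U \<in> \<H>" for U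
      using A that openin_vietoris_diamond[OF openin_opens_space_open[OF assms that]]
      by (auto simp: psi_def)
    ultimately show "A \<in> \<psi> X \<H>" by (auto simp: psi_def)
  qed blast
qed

lemma phi_psi:
  assumes "openin (\<^bold>O X) \<H>"
  shows "\<phi> X (\<psi> X \<H>) = \<H>"
  using openin_opens_space_open[OF assms]
  by (auto simp: phi_iff[OF psi_compact_saturated[OF assms]] psi_subset_diamond_iff[OF assms])

text \<open>By saturation \<open>\<K>\<close> is upward closed. So if a closed \<open>A\<close> is
  not in \<open>\<K>\<close>, no member of \<open>\<K>\<close> lies inside \<open>A\<close>; all of
  them meet the complement of \<open>A\<close>, which therefore belongs to
  \<open>\<phi> X \<K>\<close> although \<open>A\<close> misses it.\<close>

lemma psi_phi:
  assumes \<K>: "\<K> \<in> compact_saturated_sets (\<^bold>A X)"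
  shows "\<psi> X (\<phi> X \<K>) = \<K>"
proof (intro equalityI subsetI)
  have closed: "\<K> \<subseteq> closed_sets X"
    using \<K> by (auto simp: compact_saturated_sets_def compactin_def)
  show "A \<in> \<psi> X (\<phi> X \<K>)" if "A \<in> \<K>" for A
    using that closed by (auto simp: psi_def phi_iff[OF \<K>])
  fix A assume A: "A \<in> \<psi> X (\<phi> X \<K>)"
  then have cl: "closedin X A" by (simp add: psi_def closed_sets_def)
  have sat: "\<K> = \<Inter>{W. openin (\<^bold>A X) W \<and> \<K> \<subseteq> W}"
    using \<K> by (simp add: compact_saturated_sets_def saturatedin_def)
  have up: "A \<in> \<K>" if "B \<in> \<K>" "B \<subseteq> A" for B
  proof (subst sat, intro InterI)
    fix W assume "W \<in> {W. openin (\<^bold>A X) W \<and> \<K> \<subseteq> W}"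
    then show "A \<in> W"
      using that openin_lower_space_up[OF _ _ \<open>B \<subseteq> A\<close> cl] by blast
  qed
  show "A \<in> \<K>"
  proof (rule ccontr)
    assume "A \<notin> \<K>"
    have "B \<inter> (topspace X - A) \<noteq> {}" if "B \<in> \<K>" for B
    proof -
      have "B \<subseteq> topspace X"
        using that closed by (auto simp: closed_sets_def dest: closedin_subset)
      then show ?thesis using up[OF that] \<open>A \<notin> \<K>\<close> by blast
    qed
    then have "\<K> \<subseteq> vietoris_diamond X (topspace X - A)"
      using closed by (auto simp: vietoris_diamond_def)
    then have "topspace X - A \<in> \<phi> X \<K>"
      using cl by (simp add: phi_iff[OF \<K>] openin_diff)
    then show False
      using A by (auto simp: psi_def vietoris_diamond_def)
  qed
qed

text \<open>Distributivity turns a finite union of finite intersections of diamonds into a finite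
  intersection of finite unions, and a union of diamonds is again a diamond.\<close>

lemma compactin_lower_space_diamonds:
  assumes "compactin (\<^bold>A X) \<K>" "openin (\<^bold>A X) W" "\<K> \<subseteq> W"
  obtains \<U> where "finite \<U>" "\<And>U. U \<in> \<U> \<Longrightarrow> openin X U"
    "\<And>U. U \<in> \<U> \<Longrightarrow> \<K> \<subseteq> vietoris_diamond X U"
    "closed_sets X \<inter> (\<Inter>U\<in>\<U>. vietoris_diamond X U) \<subseteq> W"
proof -
  define meets where "meets = (\<lambda>F. closed_sets X \<inter> (\<Inter>U\<in>F. vietoris_diamond X U))"
  define \<B> where "\<B> = {F. finite F \<and> F \<subseteq> {U. openin X U} \<and> meets F \<subseteq> W}"
  have "\<K> \<subseteq> \<Union>(meets ` \<B>)"
  proof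
    fix A assume "A \<in> \<K>"
    with assms(3) have "A \<in> W" by blast
    with assms(2) show "A \<in> \<Union>(meets ` \<B>)"
    proof (rule openin_lower_space_basic)
      fix F
      assume "finite F" "\<And>U. U \<in> F \<Longrightarrow> openin X U" "A \<in> closed_sets X"
        "A \<in> (\<Inter>U\<in>F. vietoris_diamond X U)"
        "closed_sets X \<inter> (\<Inter>U\<in>F. vietoris_diamond X U) \<subseteq> W"
      then have "F \<in> \<B>" "A \<in> meets F" unfolding \<B>_def meets_def by auto
      then show ?thesis by blast
    qed
  qed
  moreover have "openin (\<^bold>A X) V" if V: "V \<in> meets ` \<B>" for V
  proof -
    obtain F where F: "finite F" "F \<subseteq> {U. openin X U}" "V = meets F"
      using V unfolding \<B>_def by blast
    have "openin (\<^bold>A X) ((\<Inter>U\<in>F. vietoris_diamond X U) \<inter> topspace (\<^bold>A X))"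
      using F by (intro openin_INT openin_vietoris_diamond) auto
    then show ?thesis by (simp add: F meets_def Int_commute)
  qed
  ultimately obtain \<V> where "finite \<V>" "\<V> \<subseteq> meets ` \<B>" "\<K> \<subseteq> \<Union>\<V>"
    using assms(1) unfolding compactin_def by meson
  then obtain \<F> where \<F>: "\<F> \<subseteq> \<B>" "finite \<F>" "\<K> \<subseteq> \<Union>(meets ` \<F>)"
    by (metis finite_subset_image)
  \<comment> \<open>Each choice of one set from every \<open>F \<in> \<F>\<close> contributes the
    union of the chosen sets. An empty \<open>F\<close> admits no choice and leaves
    \<open>\<U>\<close> empty, which fits because \<open>meets {}\<close> is the whole
    space.\<close>
  define \<U> where "\<U> = (\<lambda>g. \<Union>F\<in>\<F>. g F) ` (\<Pi>\<^sub>E F\<in>\<F>. F)"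
  show thesis
  proof
    show "finite \<U>"
      unfolding \<U>_def using \<F> by (intro finite_imageI finite_PiE) (auto simp: \<B>_def)
    show "openin X U" if "U \<in> \<U>" for U
      using that \<F>(1) unfolding \<U>_def \<B>_def by (auto intro!: openin_Union dest!: PiE_mem)
    show "\<K> \<subseteq> vietoris_diamond X U" if U: "U \<in> \<U>" for U
    proof
      fix A assume "A \<in> \<K>"
      then obtain F where F: "F \<in> \<F>" "A \<in> meets F" using \<F>(3) by blast
      obtain g where g: "g \<in> (\<Pi>\<^sub>E F\<in>\<F>. F)" "U = (\<Union>F\<in>\<F>. g F)"
        using U unfolding \<U>_def by blast
      then have "A \<in> vietoris_diamond X (g F)"
        using F PiE_mem[OF g(1) F(1)] unfolding meets_def by blast
      then show "A \<in> vietoris_diamond X U"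
        using F(1) g(2) unfolding vietoris_diamond_def by blast
    qed
    show "closed_sets X \<inter> (\<Inter>U\<in>\<U>. vietoris_diamond X U) \<subseteq> W"
    proof
      fix A assume A: "A \<in> closed_sets X \<inter> (\<Inter>U\<in>\<U>. vietoris_diamond X U)"
      show "A \<in> W"
      proof (rule ccontr)
        assume "A \<notin> W"
        \<comment> \<open>Choosing from each \<open>F\<close> a set that \<open>A\<close> misses
          yields a member of \<open>\<U>\<close> that \<open>A\<close> misses.\<close>
        have "\<exists>U\<in>F. A \<inter> U = {}" if "F \<in> \<F>" for F
        proof -
          have "meets F \<subseteq> W" using that \<F>(1) by (auto simp: \<B>_def)
          with \<open>A \<notin> W\<close> have "A \<notin> meets F" by blast
          with A show ?thesis by (auto simp: meets_def vietoris_diamond_def)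
        qed
        then obtain g where g: "\<And>F. F \<in> \<F> \<Longrightarrow> g F \<in> F \<and> A \<inter> g F = {}" by metis
        then have "restrict g \<F> \<in> (\<Pi>\<^sub>E F\<in>\<F>. F)" by auto
        then have "(\<Union>F\<in>\<F>. restrict g \<F> F) \<in> \<U>" unfolding \<U>_def by (rule imageI)
        then have "A \<in> vietoris_diamond X (\<Union>F\<in>\<F>. restrict g \<F> F)"
          using A by blast
        then show False
          using g by (auto simp: vietoris_diamond_def)
      qed
    qed
  qed
qed

section \<open>The Scott topology on the second iterate of the open set lattice\<close>

text \<open>Joins of Scott-open families are unions, and \<open>U\<close> lies in a union only by
  lying in one of its members.\<close>

lemma boxtimes_scott_open:
  assumes "openin X U"
  shows "openin (\<^bold>O (\<^bold>O X)) (\<boxtimes> X U)"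
  by (rule scott_open_opensI) (auto simp: boxtimes_def)

text \<open>There are only countably many finite unions of basic sets, and every open set is the
  directed union of those it contains. Hence one countable \<open>\<B>\<close> generates every
  Scott-open \<open>\<H>\<close> upward.\<close>

lemma second_countable_opens_space_countable_base:
  assumes "second_countable X"
  obtains \<B> where "countable \<B>" "\<And>B. B \<in> \<B> \<Longrightarrow> openin X B"
    "\<And>\<H> U. openin (\<^bold>O X) \<H> \<Longrightarrow> U \<in> \<H> \<Longrightarrow> \<exists>B\<in>\<B>. B \<in> \<H> \<and> B \<subseteq> U"
proof -
  obtain \<B> where \<B>: "countable \<B>" "\<forall>V\<in>\<B>. openin X V"
    "\<forall>U x. openin X U \<and> x \<in> U \<longrightarrow> (\<exists>V\<in>\<B>. x \<in> V \<and> V \<subseteq> U)"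
    using assms unfolding second_countable_def by blast
  show thesis
  proof
    show "countable (Union ` {\<F>. finite \<F> \<and> \<F> \<subseteq> \<B>})"
      using \<B>(1) by (intro countable_image countable_Collect_finite_subset)
    show "openin X B" if "B \<in> Union ` {\<F>. finite \<F> \<and> \<F> \<subseteq> \<B>}" for B
      using that \<B>(2) by (auto intro!: openin_Union)
    fix \<H> U assume \<H>: "openin (\<^bold>O X) \<H>" "U \<in> \<H>"
    have "\<Union>{V \<in> \<B>. V \<subseteq> U} = U"
      using \<B>(3) openin_opens_space_open[OF \<H>] by blast
    then obtain \<F> where "finite \<F>" "\<F> \<subseteq> {V \<in> \<B>. V \<subseteq> U}" "\<Union>\<F> \<in> \<H>"
      using openin_opens_space_Union[OF \<H>(1), of "{V \<in> \<B>. V \<subseteq> U}"] \<B>(2) \<H>(2) by auto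
    then show "\<exists>B\<in>Union ` {\<F>. finite \<F> \<and> \<F> \<subseteq> \<B>}. B \<in> \<H> \<and> B \<subseteq> U"
      by (intro bexI[of _ "\<Union>\<F>"]) auto
  qed
qed

text \<open>In topological terms, finitely many sets \<open>\<boxtimes> X U\<close> intersect in a
  neighbourhood of \<open>\<H>\<close> inside \<open>\<W>\<close>; this is what makes them a
  subbasis.\<close>

lemma scott_open_finitely_determined:
  assumes "second_countable X" and \<W>: "openin (\<^bold>O (\<^bold>O X)) \<W>" and "\<H> \<in> \<W>"
  shows "\<exists>F. finite F \<and> F \<subseteq> \<H> \<and> (\<forall>\<N>. openin (\<^bold>O X) \<N> \<longrightarrow> F \<subseteq> \<N> \<longrightarrow> \<N> \<in> \<W>)"
proof (rule ccontr)
  assume "\<not> ?thesis"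
  then have contra: "\<exists>\<N>. openin (\<^bold>O X) \<N> \<and> F \<subseteq> \<N> \<and> \<N> \<notin> \<W>" if "finite F" "F \<subseteq> \<H>" for F
    using that by metis
  have \<H>: "openin (\<^bold>O X) \<H>"
    using openin_opens_space_open[OF \<W> \<open>\<H> \<in> \<W>\<close>] .
  obtain \<B> where \<B>: "countable \<B>" "\<And>U. U \<in> \<H> \<Longrightarrow> \<exists>B\<in>\<B>. B \<in> \<H> \<and> B \<subseteq> U"
    using second_countable_opens_space_countable_base[OF assms(1)] \<H> by metis
  \<comment> \<open>\<open>to_nat_on\<close> is injective on the countable \<open>\<B>\<close>, so
    each stage \<open>F n\<close> is finite; the stages grow to all of
    \<open>\<B> \<inter> \<H>\<close>.\<close>
  define F where "F = (\<lambda>n. {B \<in> \<B> \<inter> \<H>. to_nat_on \<B> B \<le> n})"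
  have "finite (F n)" for n
  proof (rule inj_on_finite)
    show "inj_on (to_nat_on \<B>) (F n)"
      using inj_on_to_nat_on[OF \<B>(1)] by (rule inj_on_subset) (auto simp: F_def)
    show "to_nat_on \<B> ` F n \<subseteq> {..n}" by (auto simp: F_def)
  qed simp
  moreover have "F n \<subseteq> \<H>" for n by (auto simp: F_def)
  ultimately have "\<exists>\<N>. openin (\<^bold>O X) \<N> \<and> F n \<subseteq> \<N> \<and> \<N> \<notin> \<W>" for n
    by (rule contra)
  then obtain N where N: "\<And>n. openin (\<^bold>O X) (N n)" "\<And>n. F n \<subseteq> N n" "\<And>n. N n \<notin> \<W>"
    by metis
  \<comment> \<open>Some generator \<open>B\<close> below \<open>U\<close> belongs to
    \<open>F m\<close>, hence to \<open>N m\<close>, from its own index on; upward closure carries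
    this to \<open>U\<close>.\<close>
  have tail: "\<exists>k. \<forall>m\<ge>k. U \<in> N m" if U: "U \<in> \<H>" for U
  proof -
    obtain B where B: "B \<in> \<B>" "B \<in> \<H>" "B \<subseteq> U" using \<B>(2)[OF U] by blast
    have "U \<in> N m" if "m \<ge> to_nat_on \<B> B" for m
    proof -
      have "B \<in> N m" using that B N(2)[of m] by (auto simp: F_def)
      then show ?thesis
        using openin_opens_space_up[OF N(1)] B(3) openin_opens_space_open[OF \<H> U] by blast
    qed
    then show ?thesis by blast
  qed
  \<comment> \<open>An infinite intersection of Scott-open sets need not be Scott open. Intersecting
    with \<open>\<H>\<close> brings in \<open>tail\<close>, by which any fixed member of
    \<open>\<H>\<close> satisfies all but finitely many of the constraints.\<close>
  define G where "G = (\<lambda>n. \<H> \<inter> (\<Inter>m\<in>{n..}. N m))"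
  have G_open: "openin (\<^bold>O X) (G n)" for n
  proof (rule scott_open_opensI)
    show "openin X U" if "U \<in> G n" for U
      using that openin_opens_space_open[OF \<H>] by (simp add: G_def)
    show "V \<in> G n" if "U \<in> G n" "openin X V" "U \<subseteq> V" for U V
      using that openin_opens_space_up[OF \<H> _ that(3,2)]
        openin_opens_space_up[OF N(1) _ that(3,2)]
      by (auto simp: G_def)
    fix D :: "'a set set"
    assume D: "\<And>U. U \<in> D \<Longrightarrow> openin X U" "directed_subset D" "\<Union>D \<in> G n"
    have "\<exists>V\<in>D. V \<in> \<H>"
      using D openin_opens_space_directed[OF \<H>] by (simp add: G_def)
    then obtain V where V: "V \<in> D" "V \<in> \<H>" by blast
    obtain k where k: "\<And>m. m \<ge> k \<Longrightarrow> V \<in> N m" using tail[OF V(2)] by blast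
    \<comment> \<open>Only the finitely many indices below \<open>k\<close> remain to be dealt with.\<close>
    have "openin (\<^bold>O X) (\<Inter>(insert \<H> (N ` {n..<k + n})))"
      using \<H> N(1) by (intro openin_Inter) auto
    moreover have "\<Union>D \<in> \<Inter>(insert \<H> (N ` {n..<k + n}))"
      using D(3) by (auto simp: G_def)
    ultimately obtain U where U: "U \<in> D" "U \<in> \<Inter>(insert \<H> (N ` {n..<k + n}))"
      using openin_opens_space_directed D by meson
    \<comment> \<open>\<open>U\<close> meets the finitely many early constraints and
      \<open>V\<close> the late ones, so an upper bound in \<open>D\<close> meets them all.\<close>
    obtain Z where Z: "Z \<in> D" "U \<subseteq> Z" "V \<subseteq> Z"
      using D(2) U(1) V(1) unfolding directed_subset_def by meson
    have "Z \<in> N m" if "m \<ge> n" for m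
    proof (cases "m < k + n")
      case True
      with U that have "U \<in> N m" by auto
      then show ?thesis using openin_opens_space_up[OF N(1)] Z D(1) by blast
    next
      case False
      then have "V \<in> N m" by (intro k) simp
      then show ?thesis using openin_opens_space_up[OF N(1)] Z D(1) by blast
    qed
    moreover have "Z \<in> \<H>" using openin_opens_space_up[OF \<H> V(2)] Z D(1) by blast
    ultimately show "\<exists>U\<in>D. U \<in> G n" using Z(1) by (auto simp: G_def)
  qed
  have "\<Union>(range G) = \<H>"
    using tail by (fastforce simp: G_def)
  moreover have "directed_subset (range G)"
    unfolding directed_subset_def
  proof (intro conjI ballI)
    fix x y assume "x \<in> range G" "y \<in> range G"
    then obtain i j where "x = G i" "y = G j" by blast
    moreover have "G i \<subseteq> G (max i j)" "G j \<subseteq> G (max i j)" by (auto simp: G_def)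
    ultimately show "\<exists>z\<in>range G. x \<le> z \<and> y \<le> z" by blast
  qed simp
  ultimately obtain n where "G n \<in> \<W>"
    using openin_opens_space_directed[OF \<W>, of "range G"] G_open \<open>\<H> \<in> \<W>\<close> by auto
  \<comment> \<open>The index \<open>m = n\<close> occurs in the intersection, so upward closure of
    \<open>\<W>\<close> forces the excluded \<open>N n\<close> into \<open>\<W>\<close>.\<close>
  moreover have "G n \<subseteq> N n" by (auto simp: G_def)
  ultimately have "N n \<in> \<W>"
    using openin_opens_space_up[OF \<W>] N(1) by metis
  with N(3) show False by blast
qed

lemma opens_opens_space_subbasis:
  assumes "second_countable X"
  shows "\<^bold>O (\<^bold>O X) = topology_from_subbasis {\<H>. openin (\<^bold>O X) \<H>} {\<boxtimes> X U |U. openin X U}"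
proof (rule topology_eq[THEN iffD2], intro allI iffI)
  fix \<W> assume \<W>: "openin (\<^bold>O (\<^bold>O X)) \<W>"
  show "openin (topology_from_subbasis {\<H>. openin (\<^bold>O X) \<H>} {\<boxtimes> X U |U. openin X U}) \<W>"
    unfolding openin_topology_from_subbasis_iff
  proof (intro conjI ballI)
    show "\<W> \<subseteq> {\<H>. openin (\<^bold>O X) \<H>}" using openin_opens_space_open[OF \<W>] by blast
    fix \<H> assume "\<H> \<in> \<W>"
    then have \<H>: "openin (\<^bold>O X) \<H>" using openin_opens_space_open[OF \<W>] by blast
    obtain F where F: "finite F" "F \<subseteq> \<H>" "\<And>\<N>. openin (\<^bold>O X) \<N> \<Longrightarrow> F \<subseteq> \<N> \<Longrightarrow> \<N> \<in> \<W>"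
      using scott_open_finitely_determined[OF assms \<W> \<open>\<H> \<in> \<W>\<close>] by blast
    show "\<exists>\<F>. finite \<F> \<and> \<F> \<subseteq> {\<boxtimes> X U |U. openin X U} \<and> \<H> \<in> \<Inter>\<F> \<and>
            {\<H>. openin (\<^bold>O X) \<H>} \<inter> \<Inter>\<F> \<subseteq> \<W>"
    proof (intro exI[of _ "\<boxtimes> X ` F"] conjI)
      show "\<boxtimes> X ` F \<subseteq> {\<boxtimes> X U |U. openin X U}"
        using F(2) openin_opens_space_open[OF \<H>] by blast
      show "\<H> \<in> \<Inter>(\<boxtimes> X ` F)" using F(2) \<H> by (auto simp: boxtimes_def)
      show "{\<H>. openin (\<^bold>O X) \<H>} \<inter> \<Inter>(\<boxtimes> X ` F) \<subseteq> \<W>"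
        using F(3) by (auto simp: boxtimes_def)
    qed (simp add: F)
  qed
next
  fix \<W>
  assume "openin (topology_from_subbasis {\<H>. openin (\<^bold>O X) \<H>} {\<boxtimes> X U |U. openin X U}) \<W>"
  then show "openin (\<^bold>O (\<^bold>O X)) \<W>"
    by (rule topology_from_subbasis_le[rotated 2]) (auto intro: boxtimes_scott_open)
qed

section \<open>Continuity of the two maps\<close>

lemma continuous_map_psi: "continuous_map (\<^bold>O (\<^bold>O X)) (\<^bold>K (\<^bold>A X)) (\<psi> X)"
  unfolding upper_space_def
proof (rule continuous_map_into_subbasis)
  show "\<psi> X \<H> \<in> compact_saturated_sets (\<^bold>A X)" if "\<H> \<in> topspace (\<^bold>O (\<^bold>O X))" for \<H>
    using that by (intro psi_compact_saturated) simp
  fix B assume "B \<in> {vietoris_box (\<^bold>A X) W |W. openin (\<^bold>A X) W}"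
  then obtain W where W: "openin (\<^bold>A X) W" "B = vietoris_box (\<^bold>A X) W" by blast
  show "openin (\<^bold>O (\<^bold>O X)) {\<H> \<in> topspace (\<^bold>O (\<^bold>O X)). \<psi> X \<H> \<in> B}"
  proof (subst openin_subopen, intro ballI)
    fix \<H> assume "\<H> \<in> {\<H> \<in> topspace (\<^bold>O (\<^bold>O X)). \<psi> X \<H> \<in> B}"
    then have \<H>: "openin (\<^bold>O X) \<H>" "\<psi> X \<H> \<subseteq> W" "compactin (\<^bold>A X) (\<psi> X \<H>)"
      by (auto simp: W vietoris_box_def compact_saturated_sets_def)
    \<comment> \<open>Compactness replaces \<open>W\<close> by finitely many diamonds around
      \<open>\<psi> X \<H>\<close>; the dictionary turns these into finitely many memberships in
      \<open>\<H>\<close>, which define the neighbourhood \<open>V\<close>.\<close>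
    obtain \<U> where \<U>: "finite \<U>" "\<And>U. U \<in> \<U> \<Longrightarrow> openin X U"
      "\<And>U. U \<in> \<U> \<Longrightarrow> \<psi> X \<H> \<subseteq> vietoris_diamond X U"
      "closed_sets X \<inter> (\<Inter>U\<in>\<U>. vietoris_diamond X U) \<subseteq> W"
      using compactin_lower_space_diamonds[OF \<H>(3) W(1) \<H>(2)] by metis
    define V where "V = (\<Inter>U\<in>\<U>. \<boxtimes> X U) \<inter> topspace (\<^bold>O (\<^bold>O X))"
    have "openin (\<^bold>O (\<^bold>O X)) V"
      unfolding V_def using \<U>(1,2) by (intro openin_INT boxtimes_scott_open)
    moreover have "\<H> \<in> V"
      using \<H>(1) \<U>(2,3) psi_subset_diamond_iff[OF \<H>(1)] by (auto simp: V_def boxtimes_def)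
    moreover have "V \<subseteq> {\<H> \<in> topspace (\<^bold>O (\<^bold>O X)). \<psi> X \<H> \<in> B}"
    proof
      fix \<N> assume \<N>: "\<N> \<in> V"
      then have "\<psi> X \<N> \<subseteq> closed_sets X \<inter> (\<Inter>U\<in>\<U>. vietoris_diamond X U)"
        unfolding V_def boxtimes_def psi_def by blast
      then show "\<N> \<in> {\<H> \<in> topspace (\<^bold>O (\<^bold>O X)). \<psi> X \<H> \<in> B}"
        using \<N> \<U>(4) psi_compact_saturated[of X \<N>] by (auto simp: V_def W vietoris_box_def)
    qed
    ultimately show "\<exists>V. openin (\<^bold>O (\<^bold>O X)) V \<and> \<H> \<in> V \<and>
        V \<subseteq> {\<H> \<in> topspace (\<^bold>O (\<^bold>O X)). \<psi> X \<H> \<in> B}"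
      by blast
  qed
qed

text \<open>As the sets \<open>\<boxtimes> X U\<close> form a subbasis, only their preimages matter,
  and by the definition of \<open>\<phi>\<close> these are boxes of diamonds.\<close>

lemma continuous_map_phi:
  assumes "second_countable X"
  shows "continuous_map (\<^bold>K (\<^bold>A X)) (\<^bold>O (\<^bold>O X)) (\<phi> X)"
  unfolding opens_opens_space_subbasis[OF assms]
proof (rule continuous_map_into_subbasis)
  show "\<phi> X \<K> \<in> {\<H>. openin (\<^bold>O X) \<H>}" if "\<K> \<in> topspace (\<^bold>K (\<^bold>A X))" for \<K>
    using that by (simp add: openin_phi)
  fix B assume "B \<in> {\<boxtimes> X U |U. openin X U}"
  then obtain U where U: "openin X U" "B = \<boxtimes> X U" by blast
  have "{\<K> \<in> topspace (\<^bold>K (\<^bold>A X)). \<phi> X \<K> \<in> B} = vietoris_box (\<^bold>A X) (vietoris_diamond X U)"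
    using U(1) by (auto simp: U(2) boxtimes_def vietoris_box_def openin_phi phi_iff)
  moreover have "openin (\<^bold>K (\<^bold>A X)) \<dots>"
    unfolding upper_space_def using openin_vietoris_diamond[OF U(1)]
    by (intro openin_subbasis_member) (auto simp: vietoris_box_def)
  ultimately show "openin (\<^bold>K (\<^bold>A X)) {\<K> \<in> topspace (\<^bold>K (\<^bold>A X)). \<phi> X \<K> \<in> B}"
    by simp
qed

theorem theorem6p11:
  fixes X :: "'a topology"
  assumes "second_countable X"
  shows "homeomorphic_maps (\<^bold>K (\<^bold>A X)) (\<^bold>O (\<^bold>O X)) (\<phi> X) (\<psi> X) \<and>
         \<^bold>O (\<^bold>O X) = topology_from_subbasis {\<H>. openin (\<^bold>O X) \<H>} {\<boxtimes> X U |U. openin X U}"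
  unfolding homeomorphic_maps_def
proof (intro conjI ballI)
  show "continuous_map (\<^bold>K (\<^bold>A X)) (\<^bold>O (\<^bold>O X)) (\<phi> X)"
    by (rule continuous_map_phi[OF assms])
  show "continuous_map (\<^bold>O (\<^bold>O X)) (\<^bold>K (\<^bold>A X)) (\<psi> X)"
    by (rule continuous_map_psi)
  show "\<psi> X (\<phi> X \<K>) = \<K>" if "\<K> \<in> topspace (\<^bold>K (\<^bold>A X))" for \<K>
    using that by (intro psi_phi) simp
  show "\<phi> X (\<psi> X \<H>) = \<H>" if "\<H> \<in> topspace (\<^bold>O (\<^bold>O X))" for \<H>
    using that by (intro phi_psi) simp
qed (rule opens_opens_space_subbasis[OF assms])

end
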